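(* Let $S\subset\mathbb{R}^n$, $\bar x\in S$, $f:S\to\mathbb{R}$, let $f'(\bar x,\cdot)$ be a directional derivative of $f$ at $\bar x$ with corresponding cone $T\subseteq\mathbb{R}^n$, and let $h:T\to\mathbb{R}$, $h(g)=f'(\bar x,g)$ for all $g\in T$. Let $K$ be the negative dual cone of $T$ and let $E^*$ be a generalized upper exhauster of $h$. If $C_1,C_2\in E^*$ with $C_1\neq C_2$ satisfy $C_1\preceq_K^{m_2}C_2$, then $\bar E^*=E^*\setminus\{C_1\}$ is also a generalized upper exhauster of $h$.
   Context: A cone is a nonempty set $D$ with $\lambda y\in D$ for all $y\in D$, $\lambda\ge 0$. A function $h:T\to\mathbb{R}$ on a cone $T\subseteq\mathbb{R}^n$ is positively homogeneous if $h(\lambda g)=\lambda h(g)$ for all $g\in T$, $\lambda\ge 0$. The directional derivative $f'(\bar x,\cdot)$ may be taken in any sense (Dini, Hadamard, Clarke, Michel-Penot, etc.), and $T$ is the cone of directions that corresponds to the chosen derivative (for instance, for the Hadamard upper derivative $\limsup_{(\alpha,g')\to(0^+,g)}\frac1\alpha[f(\bar x+\alpha g')-f(\bar x)]$, $T$ is the contingent cone of $S$ at $\bar x$, i.e. the set of $y$ for which there are $d_k\to0^+$, $y_k\to y$ with $\bar x+d_ky_k\in S$ for all $k$). What is assumed is that $T$ is a cone in $\mathbb{R}^n$ and that $h=f'(\bar x,\cdot)$ is a real-valued positively homogeneous function on $T$. The negative dual cone of $T$ is $K=\{w\in\mathbb{R}^n:\langle w,g\rangle\le 0\ \forall g\in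 T\}$. As an ordering cone, $K$ is assumed convex, closed, pointed, containing $0$, and with nonempty interior. A generalized upper exhauster of $h:T\to\mathbb{R}$ is a family $E^*$ of nonempty closed convex subsets of $\mathbb{R}^n$ such that $h(g)=\inf_{C\in E^*}\max_{v\in C}\langle v,g\rangle$ for all $g\in T$. The Minkowski (Pontryagin) difference is $A\dot{-}B=\{x\in\mathbb{R}^n: x+B\subset A\}$. For nonempty $A,B\subset\mathbb{R}^n$, $A\preceq_K^{m_2}B$ means $(A\dot{-}B)\cap(-K)\neq\emptyset$. *)

theory Defs
  imports "HOL-Analysis.Analysis"
begin

text \<open>The library predicate \<^const>\<open>cone\<close> also holds of the empty set; nonemptiness is therefore
  required separately wherever a cone is meant to be nonempty.\<close>

definition positively_homogeneous_on ::
    "'a::real_vector set \<Rightarrow> ('a \<Rightarrow> real) \<Rightarrow> bool" where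
  "positively_homogeneous_on T h \<longleftrightarrow> (\<forall>g\<in>T. \<forall>c\<ge>0. h (c *\<^sub>R g) = c * h g)"

definition negative_dual_cone :: "'a::real_inner set \<Rightarrow> 'a set" where
  "negative_dual_cone T = {w. \<forall>g\<in>T. w \<bullet> g \<le> 0}"

definition ordering_cone :: "'a::real_normed_vector set \<Rightarrow> bool" where
  "ordering_cone K \<longleftrightarrow> cone K \<and> convex K \<and> closed K \<and> 0 \<in> K
     \<and> K \<inter> uminus ` K = {0} \<and> interior K \<noteq> {}"

text \<open>The members of a generalized exhauster need not be bounded, so the inner maximum
  and the outer infimum are taken in the extended reals; the equation forces the infimum to be
  the finite value \<open>h g\<close>. The inner maximum is rendered as a supremum, which is the maximum
  whenever it is attained.\<close>

definition generalized_upper_exhauster ::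
    "'a::real_inner set \<Rightarrow> ('a \<Rightarrow> real) \<Rightarrow> 'a set set \<Rightarrow> bool" where
  "generalized_upper_exhauster T h E \<longleftrightarrow>
     (\<forall>C\<in>E. C \<noteq> {} \<and> closed C \<and> convex C) \<and>
     (\<forall>g\<in>T. ereal (h g) = (INF C\<in>E. SUP v\<in>C. ereal (v \<bullet> g)))"

definition minkowski_difference :: "'a::plus set \<Rightarrow> 'a set \<Rightarrow> 'a set" where
  "minkowski_difference A B = {x. (\<lambda>b. x + b) ` B \<subseteq> A}"

definition m2_le :: "'a::ab_group_add set \<Rightarrow> 'a set \<Rightarrow> 'a set \<Rightarrow> bool" where
  "m2_le K A B \<longleftrightarrow> minkowski_difference A B \<inter> uminus ` K \<noteq> {}"

end

theory Submission
  imports Defs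
begin

text \<open>Write \<open>p\<^sub>C(g)\<close> for the supremum of \<open>v \<bullet> g\<close> over \<open>v \<in> C\<close>. The hypothesis on \<open>C1\<close> and \<open>C2\<close>
  provides a translate \<open>x + C2 \<subseteq> C1\<close> with \<open>x \<in> -K\<close>. As \<open>K\<close> is the negative dual cone of \<open>T\<close>, such an
  \<open>x\<close> satisfies \<open>x \<bullet> g \<ge> 0\<close> for every \<open>g \<in> T\<close>, so translating \<open>C2\<close> by \<open>x\<close> can only raise its support
  function on \<open>T\<close>; hence \<open>p\<^sub>C\<^sub>2 \<le> p\<^sub>C\<^sub>1\<close> there (\<open>m2_le_imp_support_le\<close>). Therefore \<open>C1\<close> never lowers the
  infimum that recovers \<open>h\<close> below the value \<open>C2\<close> already contributes, and since \<open>C2\<close> is a different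
  member of the exhauster, dropping \<open>C1\<close> leaves the infimum unchanged.\<close>

text \<open>If \<open>x + b \<in> A\<close> with \<open>x \<in> -K\<close>, then \<open>b \<bullet> g \<le> (x + b) \<bullet> g\<close>, so each value competing in the
  supremum over \<open>B\<close> is dominated by one competing in the supremum over \<open>A\<close>.\<close>

lemma m2_le_imp_support_le:
  fixes A B T :: "'a::real_inner set"
  assumes "m2_le (negative_dual_cone T) A B" and "g \<in> T"
  shows "(SUP v\<in>B. ereal (v \<bullet> g)) \<le> (SUP v\<in>A. ereal (v \<bullet> g))"
proof -
  obtain w where w: "w \<in> negative_dual_cone T" and shift: "\<And>b. b \<in> B \<Longrightarrow> - w + b \<in> A"
    using assms(1) by (force simp: m2_le_def minkowski_difference_def image_subset_iff)
  have "w \<bullet> g \<le> 0"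
    using w \<open>g \<in> T\<close> by (simp add: negative_dual_cone_def)
  then have "ereal (b \<bullet> g) \<le> ereal ((- w + b) \<bullet> g)" for b
    by (simp add: inner_diff_left)
  with shift show ?thesis
    by (blast intro: SUP_mono)
qed

lemma INF_remove_dominated:
  fixes p :: "'a \<Rightarrow> 'b::complete_lattice"
  assumes "b \<in> E" and "a \<noteq> b" and "p b \<le> p a"
  shows "(INF c\<in>E - {a}. p c) = (INF c\<in>E. p c)"
proof (rule antisym)
  show "(INF c\<in>E - {a}. p c) \<le> (INF c\<in>E. p c)"
    by (rule INF_mono) (use assms in blast)
  show "(INF c\<in>E. p c) \<le> (INF c\<in>E - {a}. p c)"
    by (rule INF_superset_mono) auto
qed

theorem theorem3p2:
  fixes S T K :: "(real ^ 'n) set"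
    and xbar :: "real ^ 'n"
    and f h :: "real ^ 'n \<Rightarrow> real"
    and dirderiv :: "(real ^ 'n) set \<Rightarrow> (real ^ 'n \<Rightarrow> real) \<Rightarrow> real ^ 'n \<Rightarrow> real ^ 'n \<Rightarrow> real"
    and dircone :: "(real ^ 'n) set \<Rightarrow> (real ^ 'n \<Rightarrow> real) \<Rightarrow> real ^ 'n \<Rightarrow> (real ^ 'n) set"
    and E :: "(real ^ 'n) set set"
    and C1 C2 :: "(real ^ 'n) set"
  assumes "xbar \<in> S"
    and "T = dircone S f xbar"
    and "T \<noteq> {}" and "cone T"
    and "\<forall>g\<in>T. h g = dirderiv S f xbar g"
    and "positively_homogeneous_on T h"
    and "K = negative_dual_cone T"
    and "ordering_cone K"
    and "generalized_upper_exhauster T h E"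
    and "C1 \<in> E" and "C2 \<in> E" and "C1 \<noteq> C2"
    and "m2_le K C1 C2"
  shows "generalized_upper_exhauster T h (E - {C1})"
proof -
  have "(INF C\<in>E - {C1}. SUP v\<in>C. ereal (v \<bullet> g)) = (INF C\<in>E. SUP v\<in>C. ereal (v \<bullet> g))"
    if "g \<in> T" for g
    using assms that by (intro INF_remove_dominated[of C2] m2_le_imp_support_le) auto
  with \<open>generalized_upper_exhauster T h E\<close> show ?thesis
    by (auto simp: generalized_upper_exhauster_def)
qed

end
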